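(* $\mathsf{SRT}^2_2 \times \mathsf{COH} \nleq_{W} \mathsf{RT}^2_2$.
   Context: A problem is a partial multifunction $\mathsf{P} : \subseteq 2^\omega \rightrightarrows 2^\omega$; elements $X \in \mathrm{dom}(\mathsf{P})$ are its instances, and elements of $\mathsf{P}(X)$ are the solutions to $X$. Colorings, pairs, numbers, etc. are coded as elements of $2^\omega$ in a standard way. $\mathsf{Q} \leq_{W} \mathsf{P}$ (Weihrauch reducibility) means there are Turing functionals $\Phi, \Psi$ such that for every instance $X$ of $\mathsf{Q}$, $\Phi^X$ is an instance of $\mathsf{P}$, and for every solution $\widehat{Y}$ to $\Phi^X$, $\Psi^{X \oplus \widehat{Y}}$ is a solution to $X$. Product $\mathsf{P}_0 \times \mathsf{P}_1$: instances are pairs $\langle X_0,X_1\rangle$ with $X_i$ a $\mathsf{P}_i$-instance; solutions are pairs $\langle Y_0,Y_1\rangle$ with $Y_i$ a $\mathsf{P}_i$-solution to $X_i$. Write $[X]^2 = \{\langle x,y\rangle \in X\times X : x<y\}$. A coloring $c:[\omega]^2\to 2$ is stable if for every $x$, $\lim_y c(x,y)$ exists. A set $H$ is homogeneous for $c$ if $c$ is constant on $[H]^2$. $\mathsf{RT}^2_2$: instances are colorings $c:[\omega]^2\to 2$; solutions are infinite homogeneous sets for $c$. $\mathsf{SRT}^2_2$: the restriction of $\mathsf{RT}^2_2$ to stable colorings. $\mathsf{COH}$: instances are sequences $\langle c_0,c_1,\dots\rangle$ with $c_i:\omega\to 2$; solutions are infinite sets $X$ such that for each $i$ there is a finite set $F$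 with $c_i$ constant on $X - F$. *)

theory Defs
  imports "HOL-Library.Nat_Bijection"
begin

type_synonym cantor = "nat \<Rightarrow> bool"

text \<open>
  Turing functionals are given by the partial recursive functions relative to an oracle.
  \<open>recf\<close> is the syntax of mu-recursive function descriptions with a basic function that queries the
  oracle; \<open>converges A f xs y\<close> is the (call-by-value) relation that, on oracle \<open>A\<close> and
  input tuple \<open>xs\<close>, \<open>f\<close> converges with output \<open>y\<close>.  The arity is that of the input tuple; a description applied to a
  tuple of unsuitable length diverges or ignores the surplus.
\<close>

datatype recf =
    Zero
  | Succ
  | Proj nat
  | Query
  | Comp recf "recf list"
  | PrimRec recf recf
  | Mu recf

inductive converges :: "cantor \<Rightarrow> recf \<Rightarrow> nat list \<Rightarrow> nat \<Rightarrow> bool" for A :: cantor where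
  zero: "converges A Zero xs 0"
| succ: "converges A Succ [x] (Suc x)"
| proj: "i < length xs \<Longrightarrow> converges A (Proj i) xs (xs ! i)"
| query: "converges A Query [x] (of_bool (A x))"
| comp: "\<lbrakk>list_all2 (\<lambda>g y. converges A g xs y) gs ys; converges A f ys z\<rbrakk>
    \<Longrightarrow> converges A (Comp f gs) xs z"
| primrec_0: "converges A f xs y \<Longrightarrow> converges A (PrimRec f g) (0 # xs) y"
| primrec_Suc: "\<lbrakk>converges A (PrimRec f g) (n # xs) r; converges A g (n # r # xs) y\<rbrakk>
    \<Longrightarrow> converges A (PrimRec f g) (Suc n # xs) y"
| mu: "\<lbrakk>converges A f (n # xs) 0; \<And>i. i < n \<Longrightarrow> \<exists>y. converges A f (i # xs) (Suc y)\<rbrakk>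
    \<Longrightarrow> converges A (Mu f) xs n"

inductive_cases converges_ZeroE: "converges A Zero xs z"
inductive_cases converges_SuccE: "converges A Succ xs z"
inductive_cases converges_ProjE: "converges A (Proj i) xs z"
inductive_cases converges_QueryE: "converges A Query xs z"
inductive_cases converges_CompE: "converges A (Comp f gs) xs z"
inductive_cases converges_PrimRec_0E: "converges A (PrimRec f g) (0 # xs) z"
inductive_cases converges_PrimRec_SucE: "converges A (PrimRec f g) (Suc n # xs) z"
inductive_cases converges_MuE: "converges A (Mu f) xs z"

lemma converges_deterministic:
  "converges A f xs y \<Longrightarrow> converges A f xs z \<Longrightarrow> y = z"
proof (induction arbitrary: z rule: converges.induct)
  case (zero xs)
  then show ?case by (auto elim: converges_ZeroE)
next
  case (succ x)
  then show ?case by (auto elim: converges_SuccE)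
next
  case (proj i xs)
  then show ?case by (auto elim: converges_ProjE)
next
  case (query x)
  then show ?case by (auto elim: converges_QueryE)
next
  case (comp xs gs ys f w)
  from comp.prems obtain zs where zs: "list_all2 (\<lambda>g y. converges A g xs y) gs zs"
    and z: "converges A f zs z"
    by (rule converges_CompE)
  have "ys = zs"
    using comp.IH(1) zs by (auto simp: list_all2_conv_all_nth intro!: nth_equalityI)
  with z comp.IH(2) show ?case by blast
next
  case (primrec_0 f xs y g)
  from primrec_0.prems primrec_0.IH show ?case by (blast elim: converges_PrimRec_0E)
next
  case (primrec_Suc f g n xs r y)
  from primrec_Suc.prems obtain r' where "converges A (PrimRec f g) (n # xs) r'"
    and "converges A g (n # r' # xs) z"
    by (rule converges_PrimRec_SucE)
  with primrec_Suc.IH show ?case by blast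
next
  case (mu f n xs)
  from mu.prems have z: "converges A f (z # xs) 0"
    and below: "\<And>i. i < z \<Longrightarrow> \<exists>y. converges A f (i # xs) (Suc y)"
    by (blast elim: converges_MuE)+
  show ?case
  proof (rule linorder_cases[of n z])
    assume "n < z"
    with below mu.IH(1) show ?thesis by blast
  next
    assume "z < n"
    with z mu.IH(2) show ?thesis by blast
  qed
qed

text \<open>\<open>turing_functional e X Y\<close>: the functional with index \<open>e\<close> maps the oracle \<open>X\<close> to \<open>Y\<close>, i.e. on
  oracle \<open>X\<close> it converges on every input, to the values of the characteristic function \<open>Y\<close>.\<close>

definition turing_functional :: "recf \<Rightarrow> cantor \<Rightarrow> cantor \<Rightarrow> bool" where
  "turing_functional e X Y \<longleftrightarrow> (\<forall>n. converges X e [n] (of_bool (Y n)))"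

lemma turing_functional_unique:
  assumes "turing_functional e X Y" "turing_functional e X Z"
  shows "Y = Z"
proof
  fix n
  have "of_bool (Y n) = (of_bool (Z n) :: nat)"
    using assms converges_deterministic unfolding turing_functional_def by blast
  then show "Y n = Z n" by (simp only: of_bool_eq_iff)
qed

text \<open>A partial multifunction: \<open>dom P\<close> is the set of instances and \<open>the (P X)\<close> is the set of
  solutions to the instance \<open>X\<close>.\<close>

type_synonym problem = "cantor \<rightharpoonup> cantor set"

definition join :: "cantor \<Rightarrow> cantor \<Rightarrow> cantor"  (infixr \<open>\<oplus>\<close> 65) where
  "(X \<oplus> Y) n = (if even n then X (n div 2) else Y (n div 2))"

definition weihrauch_reducible :: "problem \<Rightarrow> problem \<Rightarrow> bool"  (infix \<open>\<le>\<^sub>W\<close> 50) where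
  "Q \<le>\<^sub>W P \<longleftrightarrow>
    (\<exists>\<Phi> \<Psi>. \<forall>X \<in> dom Q. \<exists>X' \<in> dom P. turing_functional \<Phi> X X' \<and>
      (\<forall>Y' \<in> the (P X'). \<exists>Y \<in> the (Q X). turing_functional \<Psi> (X \<oplus> Y') Y))"

text \<open>The pair \<open>\<langle>X\<^sub>0, X\<^sub>1\<rangle>\<close> is coded as \<open>X\<^sub>0 \<oplus> X\<^sub>1\<close>; every element of Cantor space is such a code,
  in exactly one way.\<close>

definition product :: "problem \<Rightarrow> problem \<Rightarrow> problem"  (infixr \<open>\<times>\<^sub>W\<close> 70) where
  "(P\<^sub>0 \<times>\<^sub>W P\<^sub>1) X =
    (let X\<^sub>0 = (\<lambda>n. X (2 * n)); X\<^sub>1 = (\<lambda>n. X (2 * n + 1)) in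
     if X\<^sub>0 \<in> dom P\<^sub>0 \<and> X\<^sub>1 \<in> dom P\<^sub>1
     then Some {Y\<^sub>0 \<oplus> Y\<^sub>1 | Y\<^sub>0 Y\<^sub>1. Y\<^sub>0 \<in> the (P\<^sub>0 X\<^sub>0) \<and> Y\<^sub>1 \<in> the (P\<^sub>1 X\<^sub>1)}
     else None)"

definition pairs :: "nat set \<Rightarrow> (nat \<times> nat) set" where
  "pairs X = {(x, y) \<in> X \<times> X. x < y}"

text \<open>Colorings of \<open>pairs UNIV\<close> are functions on all pairs of numbers whose values outside
  \<open>pairs UNIV\<close> are never used.\<close>

definition homogeneous :: "(nat \<times> nat \<Rightarrow> bool) \<Rightarrow> nat set \<Rightarrow> bool" where
  "homogeneous c H \<longleftrightarrow> (\<exists>k. \<forall>p \<in> pairs H. c p = k)"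

definition stable :: "(nat \<times> nat \<Rightarrow> bool) \<Rightarrow> bool" where
  "stable c \<longleftrightarrow> (\<forall>x. \<exists>k. \<forall>\<^sub>F y in sequentially. c (x, y) = k)"

text \<open>A coloring \<open>c\<close> is coded by any \<open>X\<close> with \<open>X (prod_encode (x, y)) = c (x, y)\<close> for \<open>x < y\<close>;
  thus every element of Cantor space codes a coloring.\<close>

definition coloring_of :: "cantor \<Rightarrow> nat \<times> nat \<Rightarrow> bool" where
  "coloring_of X p = X (prod_encode p)"

definition RT22 :: problem where
  "RT22 X = Some {Y. infinite (Collect Y) \<and> homogeneous (coloring_of X) (Collect Y)}"

definition SRT22 :: problem where
  "SRT22 = RT22 |` {X. stable (coloring_of X)}"

text \<open>\<open>X\<close> codes the sequence of colorings whose \<open>i\<close>-th member is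
  \<open>\<lambda>n. X (prod_encode (i, n))\<close>.\<close>

definition sequence_of :: "cantor \<Rightarrow> nat \<Rightarrow> nat \<Rightarrow> bool" where
  "sequence_of X i n = X (prod_encode (i, n))"

definition COH :: problem where
  "COH X = Some {Y. infinite (Collect Y) \<and>
    (\<forall>i. \<exists>F. finite F \<and> (\<exists>k. \<forall>n \<in> Collect Y - F. sequence_of X i n = k))}"

end

theory Submission
  imports Defs "HOL-Library.Countable" "HOL-Library.Infinite_Set"
begin

text \<open>
  Suppose that \<open>\<Phi>\<close> and \<open>\<Psi>\<close> witness a reduction. Only their continuity matters: a convergent computation
  reads finitely many bits of its oracle (\<open>converges_use\<close>). The instances that defeat them are pairs
  \<open>c \<oplus> d\<close> in which \<open>c\<close> is a very simple stable coloring (\<open>switch M\<close>): either constantly \<open>0\<close>, or \<open>0\<close> on the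
  pairs whose code is below some \<open>M\<close> and \<open>1\<close> on all others. Write \<open>e\<close> for the coloring that \<open>\<Phi>\<close> computes
  from the instance.

  Take first \<open>c = 0\<close>. Once a finite \<open>e\<close>-homogeneous set \<open>F\<close> makes \<open>\<Psi>\<close> put two numbers \<open>x < y\<close> into its
  solution of \<open>c\<close>, one can let \<open>c\<close> switch to color \<open>1\<close> later. The solution is then wrong: the pair
  \<open>(x, y)\<close> has color \<open>0\<close>, but \<open>x\<close> has color \<open>1\<close> with almost every number. The new coloring \<open>e\<close> agrees
  with the old one on \<open>F\<close>, so the only escape is that \<open>F\<close> no longer extends to an infinite homogeneous
  set. Seetapun's idea closes it: fix finitely many such sets \<open>F\<close> so that every assignment \<open>f\<close> of
  a color to each number, read as a guess of the limits of \<open>e\<close>, gives some \<open>F\<close> of color \<open>i\<close> the color \<open>i\<close>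
  throughout. Whatever the limits of the new \<open>e\<close> along some infinite set \<open>R\<close> are, one of
  the sets \<open>F\<close> can be prolonged inside \<open>R\<close>, provided that \<open>R\<close> has an infinite subset homogeneous of the
  right color. By compactness of the space of all \<open>f\<close> the finitely many sets exist as soon as every
  single \<open>f\<close> admits one \<open>F\<close>; and it does if each color class \<open>{f = i}\<close>, when infinite, contains an infinite
  \<open>e\<close>-homogeneous set of color \<open>i\<close>.

  Both gaps concern an infinite set \<open>R\<close> that should contain an infinite homogeneous set of a prescribed
  color, and this is what \<open>COH\<close> is for. If \<open>R\<close> has no such subset of color \<open>j\<close>, then after restricting \<open>R\<close> to
  the common \<open>j\<close>-neighbors of finitely many points, a greedy search finds an infinite homogeneous set of the
  other color (\<open>infinite_homogeneous_subset\<close>). This set depends continuously on \<open>R\<close> and the instance, and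
  \<open>\<Psi>\<close> turns it into a cohesive set for \<open>d\<close>. It therefore suffices to choose \<open>d\<close> so that no such procedure
  yields a cohesive set. Here \<open>R\<close> may come from an arbitrary \<open>f\<close>, so one cannot demand this for all \<open>f\<close>. But
  if the set of \<open>f\<close> without any \<open>F\<close> is nonempty, it is a nonempty closed set, and for closed
  sets \<open>no_uniformly_computed_cohesive_set\<close> provides a \<open>d\<close> and a member from which all the procedures fail.
\<close>

section \<open>Finite information about points of Cantor space\<close>

definition agree :: "nat \<Rightarrow> cantor \<Rightarrow> cantor \<Rightarrow> bool" where
  "agree m X Y \<longleftrightarrow> (\<forall>k<m. X k = Y k)"

lemma agree_refl [simp]: "agree m X X"
  by (simp add: agree_def)

lemma agree_mono: "agree m X Y \<Longrightarrow> k \<le> m \<Longrightarrow> agree k X Y"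
  by (simp add: agree_def)

lemma agree_trans: "agree m X Y \<Longrightarrow> agree m Y Z \<Longrightarrow> agree m X Z"
  by (simp add: agree_def)

lemma agree_sym: "agree m X Y \<Longrightarrow> agree m Y X"
  by (simp add: agree_def)

lemma agree_join: "agree m X X' \<Longrightarrow> agree m Y Y' \<Longrightarrow> agree m (X \<oplus> Y) (X' \<oplus> Y')"
  by (auto simp: agree_def join_def)

lemma uniform_bound:
  assumes "finite S" "\<And>k. k \<in> S \<Longrightarrow> \<exists>m::nat. P k m"
    and mono: "\<And>k m m'. P k m \<Longrightarrow> m \<le> m' \<Longrightarrow> P k m'"
  shows "\<exists>m. \<forall>k\<in>S. P k m"
  using assms(1,2)
proof (induction S)
  case (insert x S)
  then obtain m1 m2 where "P x m1" "\<forall>k\<in>S. P k m2" by (metis insertCI)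
  then have "\<forall>k\<in>insert x S. P k (max m1 m2)"
    by (auto intro: mono)
  then show ?case ..
qed simp

text \<open>
  A derivation of convergence makes finitely many oracle queries.  In the rules for composition and
  minimization finitely many subcomputations are combined, whence \<open>uniform_bound\<close>.
\<close>

lemma converges_use:
  assumes "converges A f xs y"
  shows "\<exists>m. \<forall>B. agree m A B \<longrightarrow> converges B f xs y"
  using assms
proof (induction rule: converges.induct)
  case (query x)
  show ?case
  proof (intro exI allI impI)
    fix B assume "agree (Suc x) A B"
    then have "A x = B x" by (simp add: agree_def)
    then show "converges B Query [x] (of_bool (A x))" by (simp add: converges.query)
  qed
next
  case (comp xs gs ys f z)
  from comp.IH(1) have len: "length gs = length ys"
    and "\<And>k. k < length gs \<Longrightarrow> \<exists>m. \<forall>B. agree m A B \<longrightarrow> converges B (gs ! k) xs (ys ! k)"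
    by (auto simp: list_all2_conv_all_nth)
  then obtain m1 where m1: "\<forall>k\<in>{..<length gs}. \<forall>B. agree m1 A B \<longrightarrow> converges B (gs ! k) xs (ys ! k)"
    using uniform_bound[of "{..<length gs}" "\<lambda>k m. \<forall>B. agree m A B \<longrightarrow> converges B (gs ! k) xs (ys ! k)"]
    by (auto dest: agree_mono)
  from comp.IH(2) obtain m2 where m2: "\<forall>B. agree m2 A B \<longrightarrow> converges B f ys z" by blast
  show ?case
  proof (intro exI allI impI)
    fix B assume B: "agree (max m1 m2) A B"
    have "list_all2 (\<lambda>g y. converges B g xs y) gs ys"
      using m1 len agree_mono[OF B, of m1] by (auto simp: list_all2_conv_all_nth)
    moreover have "converges B f ys z" using m2 agree_mono[OF B, of m2] by auto
    ultimately show "converges B (Comp f gs) xs z" by (rule converges.comp)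
  qed
next
  case (primrec_Suc f g n xs r y)
  then obtain m1 m2 where m: "\<forall>B. agree m1 A B \<longrightarrow> converges B (PrimRec f g) (n # xs) r"
    "\<forall>B. agree m2 A B \<longrightarrow> converges B g (n # r # xs) y" by blast
  show ?case
  proof (intro exI allI impI)
    fix B assume B: "agree (max m1 m2) A B"
    show "converges B (PrimRec f g) (Suc n # xs) y"
      by (rule converges.primrec_Suc[of _ _ _ _ _ r])
        (use m agree_mono[OF B, of m1] agree_mono[OF B, of m2] in auto)
  qed
next
  case (mu f n xs)
  have "\<exists>m. \<forall>i\<in>{..<n}. \<exists>y. \<forall>B. agree m A B \<longrightarrow> converges B f (i # xs) (Suc y)"
  proof (rule uniform_bound)
    show "\<exists>m y. \<forall>B. agree m A B \<longrightarrow> converges B f (i # xs) (Suc y)" if "i \<in> {..<n}" for i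
      using mu.IH(2)[of i] that by blast
  qed (use agree_mono in blast)+
  then obtain m1 where m1: "\<forall>i\<in>{..<n}. \<exists>y. \<forall>B. agree m1 A B \<longrightarrow> converges B f (i # xs) (Suc y)" ..
  from mu.IH(1) obtain m2 where m2: "\<forall>B. agree m2 A B \<longrightarrow> converges B f (n # xs) 0" by blast
  show ?case
  proof (intro exI allI impI)
    fix B assume B: "agree (max m1 m2) A B"
    show "converges B (Mu f) xs n"
      by (rule converges.mu)
        (use m1 m2 agree_mono[OF B, of m1] agree_mono[OF B, of m2] in \<open>auto, blast\<close>)
  qed
qed (blast intro: converges.intros)+

text \<open>Longer and longer initial segments, each extending the one before, have a limit.\<close>

lemma agree_limit:
  assumes "\<And>n. t n < t (Suc n)" "\<And>n. agree (t n) (D n) (D (Suc n))"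
  shows "\<exists>d. \<forall>n. agree (t n) (D n) d"
proof -
  have tm: "strict_mono t" using assms(1) by (simp add: strict_mono_Suc_iff)
  have chain: "agree (t n) (D n) (D (n + k))" for n k
  proof (induction k)
    case (Suc k)
    have "t n \<le> t (n + k)" using tm by (simp add: strict_mono_less_eq)
    then show ?case using Suc agree_mono[OF assms(2)[of "n + k"]] agree_trans by auto
  qed simp
  define d where "d k = D (Suc k) k" for k
  have lim: "D n k = d k" if "k < t n" for n k
  proof (cases "n \<le> Suc k")
    case True
    then show ?thesis using chain[of n "Suc k - n"] that by (simp add: agree_def d_def)
  next
    case False
    have "k < t (Suc k)" using strict_mono_imp_increasing[OF tm, of "Suc k"] by simp
    then show ?thesis using chain[of "Suc k" "n - Suc k"] False by (simp add: agree_def d_def)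
  qed
  then have "\<forall>n. agree (t n) (D n) d" by (simp add: agree_def)
  then show ?thesis by blast
qed

text \<open>
  Compactness of Cantor space in the form of the fan theorem.  If no bound worked for all points, one
  could decide the bits one after the other and keep this failure true of the current cylinder; the
  limit point would have no bound of its own.
\<close>

lemma fan:
  assumes loc: "\<And>f. \<exists>m. \<forall>g. agree m f g \<longrightarrow> Q m g"
    and mono: "\<And>m m' g. Q m g \<Longrightarrow> m \<le> m' \<Longrightarrow> Q m' g"
  shows "\<exists>M. \<forall>g. Q M g"
proof (rule ccontr)
  assume no: "\<nexists>M. \<forall>g. Q M g"
  define P where "P n g \<longleftrightarrow> (\<forall>M. \<exists>h. agree n g h \<and> \<not> Q M h)" for n and g :: cantor
  have "\<exists>D. \<forall>n. P n (D n) \<and> agree n (D n) (D (Suc n))"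
  proof (rule dependent_nat_choice)
    show "\<exists>g. P 0 g" using no by (auto simp: P_def agree_def)
  next
    fix g n assume g: "P n g"
    show "\<exists>g'. P (Suc n) g' \<and> agree n g g'"
    proof (rule ccontr)
      assume "\<not> ?thesis"
      then have "\<not> P (Suc n) (g(n := b))" for b by (auto simp: agree_def)
      then obtain B where B: "\<And>b h. agree (Suc n) (g(n := b)) h \<Longrightarrow> Q (B b) h"
        unfolding P_def by metis
      obtain h where h: "agree n g h" "\<not> Q (max (B True) (B False)) h"
        using g by (auto simp: P_def)
      from h(1) have "Q (B (h n)) h" by (intro B) (auto simp: agree_def less_Suc_eq)
      then have "Q (max (B True) (B False)) h" by (rule mono) (cases "h n"; simp)
      with h(2) show False ..
    qed
  qed
  then obtain D where D: "\<And>n. P n (D n)" "\<And>n. agree n (D n) (D (Suc n))" by blast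
  have "\<exists>f. \<forall>n. agree n (D n) f"
    by (rule agree_limit[where t = "\<lambda>n. n" and D = D]) (simp_all add: D(2))
  then obtain f where f: "agree n (D n) f" for n by blast
  obtain m where m: "\<forall>g. agree m f g \<longrightarrow> Q m g" using loc by blast
  obtain h where "agree m (D m) h" "\<not> Q m h" using D(1) by (auto simp: P_def)
  with m f show False by (meson agree_sym agree_trans)
qed

text \<open>
  Openness of a relation as a subset of the product of two copies of Cantor space.
\<close>

definition open_rel :: "(cantor \<Rightarrow> cantor \<Rightarrow> bool) \<Rightarrow> bool" where
  "open_rel P \<longleftrightarrow>
    (\<forall>d f. P d f \<longrightarrow> (\<exists>m. \<forall>d' f'. agree m d d' \<longrightarrow> agree m f f' \<longrightarrow> P d' f'))"

lemma open_relE: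
  assumes "open_rel P" "P d f"
  obtains m where "\<And>d' f'. agree m d d' \<Longrightarrow> agree m f f' \<Longrightarrow> P d' f'"
  using assms unfolding open_rel_def by blast

lemma open_rel_ex: "(\<And>x. open_rel (P x)) \<Longrightarrow> open_rel (\<lambda>d f. \<exists>x. P x d f)"
  unfolding open_rel_def by meson

lemma open_rel_disj: "open_rel P \<Longrightarrow> open_rel Q \<Longrightarrow> open_rel (\<lambda>d f. P d f \<or> Q d f)"
  unfolding open_rel_def by meson

lemma open_rel_const_conj: "open_rel P \<Longrightarrow> open_rel (\<lambda>d f. c \<and> P d f)"
  unfolding open_rel_def by meson

section \<open>Defeating countably many candidate cohesive sets\<close>

text \<open>
  Each \<open>K a d\<close> is a closed set of points \<open>f\<close>, and \<open>U r d f\<close> is a set that is enumerated from \<open>d\<close> and \<open>f\<close> and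
  may try to be cohesive for \<open>d\<close>.  The family \<open>fam r\<close> tells which closed set \<open>U r\<close> draws its \<open>f\<close> from. The
  sequence \<open>d\<close> is built from longer and longer initial segments, and column \<open>to_nat r\<close> of \<open>d\<close> is reserved for
  defeating \<open>U r\<close>.  At infinitely many stages, with either value of \<open>b\<close>, one asks whether that column can be
  kept constantly \<open>b\<close> on new positions until \<open>U r d f\<close> contains a new number, for all \<open>f\<close> in the closed set.  If this
  always succeeds, column \<open>r\<close> takes both values infinitely often on \<open>U r d f\<close>.  If it fails once, then the column
  remains constant forever, and some \<open>f\<close> in the closed set never adds another number to \<open>U r d f\<close>; the closed
  set is reduced to such \<open>f\<close>.
\<close>

context
  fixes K :: "'a \<Rightarrow> cantor \<Rightarrow> cantor \<Rightarrow> bool"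
    and U :: "'r::countable \<Rightarrow> cantor \<Rightarrow> cantor \<Rightarrow> nat \<Rightarrow> bool"
    and fam :: "'r \<Rightarrow> 'a"
  assumes K_closed: "\<And>a. open_rel (\<lambda>d f. \<not> K a d f)"
    and U_open: "\<And>r z. open_rel (\<lambda>d f. U r d f z)"
begin

private definition pos :: "'r \<Rightarrow> nat \<Rightarrow> nat" where
  "pos r z = prod_encode (to_nat r, z)"

private lemma pos_inj: "pos r z = pos r' z' \<longleftrightarrow> r = r' \<and> z = z'"
  by (simp add: pos_def)

private lemma pos_ge: "z \<le> pos r z"
  by (simp add: pos_def le_prod_encode_2)

text \<open>
  A commitment \<open>L r = Some (b, s)\<close> records that the question failed for \<open>r\<close> and \<open>b\<close> when the first \<open>s\<close> bits of \<open>d\<close>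
  were fixed.  It restricts \<open>d\<close> through \<open>obeys\<close> and the closed sets through \<open>KL\<close>.
\<close>

private definition obeys :: "('r \<rightharpoonup> bool \<times> nat) \<Rightarrow> cantor \<Rightarrow> bool" where
  "obeys L d \<longleftrightarrow> (\<forall>r b s z. L r = Some (b, s) \<longrightarrow> s \<le> pos r z \<longrightarrow> d (pos r z) = b)"

private lemma obeys_update:
  assumes "L r = None"
  shows "obeys (L(r \<mapsto> (b, s))) d \<longleftrightarrow>
    obeys L d \<and> (\<forall>z. s \<le> pos r z \<longrightarrow> d (pos r z) = b)" (is "?l \<longleftrightarrow> ?r")
proof
  assume l: ?l
  then have "\<forall>z. s \<le> pos r z \<longrightarrow> d (pos r z) = b"
    unfolding obeys_def by (metis fun_upd_same)
  moreover have "obeys L d"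
    unfolding obeys_def
  proof (intro allI impI)
    fix r' b' s' z assume "L r' = Some (b', s')" "s' \<le> pos r' z"
    moreover from this have "r' \<noteq> r" using assms by auto
    ultimately show "d (pos r' z) = b'" using l unfolding obeys_def by (metis fun_upd_other)
  qed
  ultimately show ?r by blast
next
  assume r: ?r
  show ?l
    unfolding obeys_def
  proof (intro allI impI)
    fix r' b' s' z assume "(L(r \<mapsto> (b, s))) r' = Some (b', s')" "s' \<le> pos r' z"
    then show "d (pos r' z) = b'"
      using r unfolding obeys_def by (cases "r' = r") auto
  qed
qed

private definition KL :: "('r \<rightharpoonup> bool \<times> nat) \<Rightarrow> 'a \<Rightarrow> cantor \<Rightarrow> cantor \<Rightarrow> bool" where
  "KL L a d f \<longleftrightarrow> K a d f \<and>
    (\<forall>r b s z. L r = Some (b, s) \<longrightarrow> fam r = a \<longrightarrow> s \<le> pos r z \<longrightarrow> \<not> U r d f z)"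

private lemma KL_closed: "open_rel (\<lambda>d f. \<not> KL L a d f)"
proof -
  have "(\<lambda>d f. \<not> KL L a d f) = (\<lambda>d f. \<not> K a d f \<or>
    (\<exists>r b s z. (L r = Some (b, s) \<and> fam r = a \<and> s \<le> pos r z) \<and> U r d f z))"
    by (auto simp: KL_def fun_eq_iff)
  then show ?thesis
    by (simp only:) (intro open_rel_disj K_closed open_rel_ex open_rel_const_conj U_open)
qed

text \<open>
  A state \<open>(t, d, L)\<close> stands for all sequences that agree with \<open>d\<close> on the first \<open>t\<close> bits and obey \<open>L\<close>.  Closed
  sets that have been reduced must stay nonempty for all these sequences.  A step for \<open>r\<close> and \<open>b\<close> leaves \<open>r\<close>
  committed, or else fixes bits that, for every \<open>f\<close> in the current closed set, give \<open>U r d f\<close> a new element at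
  which column \<open>r\<close> has value \<open>b\<close>.
\<close>

private definition invar :: "nat \<times> cantor \<times> ('r \<rightharpoonup> bool \<times> nat) \<Rightarrow> bool" where
  "invar S \<longleftrightarrow> (case S of (t, d, L) \<Rightarrow> obeys L d \<and>
    (\<forall>r \<in> dom L. \<forall>d'. agree t d d' \<longrightarrow> obeys L d' \<longrightarrow> (\<exists>f. KL L (fam r) d' f)))"

private definition step ::
  "'r \<Rightarrow> bool \<Rightarrow> nat \<times> cantor \<times> ('r \<rightharpoonup> bool \<times> nat) \<Rightarrow> nat \<times> cantor \<times> ('r \<rightharpoonup> bool \<times> nat) \<Rightarrow> bool"
  where "step r b S S' \<longleftrightarrow> (case (S, S') of ((t, d, L), (t', d', L')) \<Rightarrow>
    t < t' \<and> agree t d d' \<and> L \<subseteq>\<^sub>m L' \<and>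
    (r \<notin> dom L' \<longrightarrow> (\<forall>d'' f. agree t' d' d'' \<longrightarrow> KL L (fam r) d'' f \<longrightarrow>
       (\<exists>z. t \<le> pos r z \<and> U r d'' f z \<and> d'' (pos r z) = b))))"

private lemma invar_extend:
  assumes "invar (t, d, L)" "agree t d d'" "t \<le> t'" "obeys L d'"
  shows "invar (t', d', L)"
  unfolding invar_def prod.case
proof (intro conjI ballI allI impI)
  fix r d'' assume "r \<in> dom L" "agree t' d' d''" "obeys L d''"
  moreover from this have "agree t d d''"
    using assms(2,3) agree_mono agree_trans by blast
  ultimately show "\<exists>f. KL L (fam r) d'' f" using assms(1) unfolding invar_def by blast
qed (fact assms(4))

private lemma step_exists:
  assumes "invar (t, d, L)"
  shows "\<exists>S'. invar S' \<and> step r b (t, d, L) S'"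
proof (cases "r \<in> dom L")
  case True
  have "invar (Suc t, d, L)"
    using invar_extend[OF assms agree_refl, of "Suc t"] assms by (simp add: invar_def)
  moreover have "step r b (t, d, L) (Suc t, d, L)"
    using True by (simp add: step_def)
  ultimately show ?thesis by blast
next
  case False
  define L' where "L' = L(r \<mapsto> (b, t))"
  have LL': "L \<subseteq>\<^sub>m L'" using False by (auto simp: L'_def map_le_def)
  have resp: "obeys L' d' \<longleftrightarrow> obeys L d' \<and> (\<forall>z. t \<le> pos r z \<longrightarrow> d' (pos r z) = b)" for d'
    unfolding L'_def using False by (intro obeys_update) auto
  show ?thesis
  proof (cases "\<exists>d'. agree t d d' \<and> obeys L' d' \<and>
      (\<forall>f. KL L (fam r) d' f \<longrightarrow> (\<exists>z. t \<le> pos r z \<and> U r d' f z))")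
    case True
    then obtain d' where d': "agree t d d'" "obeys L' d'"
      and hit: "\<And>f. KL L (fam r) d' f \<Longrightarrow> \<exists>z. t \<le> pos r z \<and> U r d' f z" by blast
    \<comment> \<open>Waiting long enough makes the new element appear for all \<open>f\<close> simultaneously and for all sequences
       that share the bits of \<open>d'\<close> used up to then.\<close>
    define Q where "Q m f \<longleftrightarrow> (\<forall>d''. agree m d' d'' \<longrightarrow>
      \<not> KL L (fam r) d'' f \<or> (\<exists>z. t \<le> pos r z \<and> pos r z < m \<and> U r d'' f z))" for m f
    have "\<exists>M. \<forall>g. Q M g"
    proof (rule fan)
      fix f
      show "\<exists>m. \<forall>g. agree m f g \<longrightarrow> Q m g"
      proof (cases "KL L (fam r) d' f")
        case True
        then obtain z where z: "t \<le> pos r z" "U r d' f z" using hit by blast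
        obtain m where m: "\<And>d'' g. agree m d' d'' \<Longrightarrow> agree m f g \<Longrightarrow> U r d'' g z"
          using open_relE[where P = "\<lambda>d f. U r d f z", OF U_open z(2)] by blast
        have "Q (max m (Suc (pos r z))) g" if "agree (max m (Suc (pos r z))) f g" for g
          unfolding Q_def
        proof (intro allI impI disjI2 exI conjI)
          fix d'' assume "agree (max m (Suc (pos r z))) d' d''"
          with that show "U r d'' g z" by (auto intro!: m elim: agree_mono)
        qed (use z in auto)
        then show ?thesis by blast
      next
        case False
        then obtain m where "\<And>d'' g. agree m d' d'' \<Longrightarrow> agree m f g \<Longrightarrow> \<not> KL L (fam r) d'' g"
          using open_relE[OF KL_closed] by blast
        then show ?thesis unfolding Q_def by blast
      qed
    next
      fix m m' g assume "Q m g" "m \<le> m'"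
      then show "Q m' g" unfolding Q_def by (meson agree_mono less_le_trans)
    qed
    then obtain M where M: "\<And>g. Q M g" by blast
    have "invar (max M (Suc t), d', L)"
      using invar_extend[OF assms d'(1)] d'(2) by (simp add: resp)
    moreover have "step r b (t, d, L) (max M (Suc t), d', L)"
      unfolding step_def
    proof (simp only: prod.case, intro conjI impI allI)
      show "agree t d d'" by fact
      fix d'' f assume d'': "agree (max M (Suc t)) d' d''" and f: "KL L (fam r) d'' f"
      then obtain z where z: "t \<le> pos r z" "pos r z < M" "U r d'' f z"
        using M[of f] agree_mono[OF d'', of M] unfolding Q_def by auto
      then have "d'' (pos r z) = b" using d'(2) d'' by (auto simp: agree_def resp)
      with z show "\<exists>z. t \<le> pos r z \<and> U r d'' f z \<and> d'' (pos r z) = b" by blast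
    qed simp_all
    ultimately show ?thesis by blast
  next
    \<comment> \<open>Every admissible sequence has an \<open>f\<close> whose \<open>U r\<close> gets no new element: make the commitment.\<close>
    case stuck: False
    define d' where "d' p = (if t \<le> p \<and> (\<exists>z. p = pos r z) then b else d p)" for p
    have agr: "agree t d d'" by (simp add: d'_def agree_def)
    have "obeys L d'"
      using assms \<open>r \<notin> dom L\<close>
      by (auto simp: invar_def obeys_def d'_def pos_inj dom_def)
    then have "obeys L' d'" by (auto simp: resp d'_def)
    have "invar (Suc t, d', L')"
      unfolding invar_def
    proof (clarify, intro conjI ballI allI impI)
      show "obeys L' d'" by fact
      fix r' d'' assume r': "r' \<in> dom L'" and d'': "agree (Suc t) d' d''" "obeys L' d''"
      have agr': "agree t d d''"
        using agr agree_mono[OF d''(1), of t] agree_trans by auto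
      show "\<exists>f. KL L' (fam r') d'' f"
      proof (cases "fam r' = fam r")
        case True
        from stuck agr' d''(2) obtain f where f: "KL L (fam r) d'' f"
          "\<And>z. t \<le> pos r z \<Longrightarrow> \<not> U r d'' f z" by blast
        then have "KL L' (fam r) d'' f"
          unfolding KL_def L'_def by (auto split: if_splits)
        with True show ?thesis by auto
      next
        case False
        then have "r' \<in> dom L" using r' by (auto simp: L'_def split: if_splits)
        then obtain f where "KL L (fam r') d'' f"
          using assms agr' d''(2) by (fastforce simp: invar_def resp)
        then have "KL L' (fam r') d'' f"
          using False unfolding KL_def L'_def by (auto split: if_splits)
        then show ?thesis by blast
      qed
    qed
    moreover have "step r b (t, d, L) (Suc t, d', L')"
      using LL' agr by (simp add: step_def L'_def)
    ultimately show ?thesis by blast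
  qed
qed

text \<open>
  The sets \<open>U r d f\<close> that never led to a commitment meet both values of column \<open>r\<close> infinitely often, the
  others are finite.  A single \<open>f\<close> serves all \<open>r\<close> of a family, since the commitments of
  one family all reduce the same closed set.
\<close>

lemma no_uniformly_computed_cohesive_set:
  "\<exists>d. \<forall>a. (\<exists>f. K a d f) \<longrightarrow>
    (\<exists>f. K a d f \<and> (\<forall>r. fam r = a \<longrightarrow> U r d f \<notin> the (COH d)))"
proof -
  define task where "task n = (from_nat n :: 'r \<times> bool \<times> nat)" for n
  have "\<exists>S. \<forall>n. invar (S n) \<and> step (fst (task n)) (fst (snd (task n))) (S n) (S (Suc n))"
  proof (rule dependent_nat_choice)
    have "invar (0, \<lambda>_. False, Map.empty)" by (simp add: invar_def obeys_def)
    then show "\<exists>S. invar S" ..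
    show "\<exists>S'. invar S' \<and> step (fst (task n)) (fst (snd (task n))) S S'" if "invar S" for S n
      using that step_exists by (cases S) blast
  qed
  then obtain S where S_invar: "\<And>n. invar (S n)"
    and S_step: "\<And>n. step (fst (task n)) (fst (snd (task n))) (S n) (S (Suc n))" by blast
  define t D L where "t n = fst (S n)" and "D n = fst (snd (S n))" and "L n = snd (snd (S n))" for n
  have S: "S n = (t n, D n, L n)" for n by (simp add: t_def D_def L_def)
  have t_less: "t n < t (Suc n)" and agr: "agree (t n) (D n) (D (Suc n))"
    and L_le: "L n \<subseteq>\<^sub>m L (Suc n)" for n
    using S_step[of n] by (auto simp: step_def S)
  have t_mono: "strict_mono t" using t_less by (simp add: strict_mono_Suc_iff)
  have L_mono: "L m \<subseteq>\<^sub>m L n" if "m \<le> n" for m n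
    using that by (induction n rule: dec_induct) (auto intro: map_le_trans L_le)
  have L_keep: "L n r = Some c" if "m \<le> n" "L m r = Some c" for m n r c
    using L_mono[OF that(1)] that(2) by (metis domI map_le_def)
  obtain d where d_agr: "agree (t n) (D n) d" for n
    using agree_limit[of t D, OF t_less agr] by blast
  have resp: "obeys (L n) d" for n
    unfolding obeys_def
  proof (intro allI impI)
    fix r b s z assume r: "L n r = Some (b, s)" "s \<le> pos r z"
    define m where "m = max n (Suc (pos r z))"
    have "pos r z < t m"
      using strict_mono_imp_increasing[OF t_mono, of m] by (simp add: m_def)
    then have "d (pos r z) = D m (pos r z)" using d_agr[of m] by (simp add: agree_def)
    moreover have "L m r = Some (b, s)"
      using L_keep[OF _ r(1), of m] by (simp add: m_def)
    ultimately show "d (pos r z) = b"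
      using S_invar[of m] r unfolding S invar_def obeys_def by auto
  qed
  have KL_mono: "KL (L n) a d' f \<Longrightarrow> m \<le> n \<Longrightarrow> KL (L m) a d' f" for m n a d' f
    using L_keep unfolding KL_def by blast
  show ?thesis
  proof (rule exI[of _ d], intro allI impI)
    fix a assume ex: "\<exists>f. K a d f"
    \<comment> \<open>The reduced closed sets decrease, so by compactness they have a common member.\<close>
    have "\<exists>f. \<forall>n. KL (L n) a d f"
    proof (cases "\<exists>n. \<exists>r \<in> dom (L n). fam r = a")
      case True
      then obtain n0 r where r: "r \<in> dom (L n0)" "fam r = a" by blast
      have ne: "\<exists>f. KL (L n) a d f" for n
      proof -
        have "r \<in> dom (L (max n0 n))"
          using L_keep[of n0 "max n0 n" r] r by auto
        then have "\<exists>f. KL (L (max n0 n)) a d f"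
          using S_invar[of "max n0 n"] resp d_agr r unfolding S invar_def by blast
        then show ?thesis using KL_mono[of "max n0 n" a d _ n] by auto
      qed
      show ?thesis
      proof (rule ccontr)
        assume none: "\<not> ?thesis"
        have "\<exists>M. \<forall>g. \<not> KL (L M) a d g"
        proof (rule fan)
          fix f
          from none obtain n where "\<not> KL (L n) a d f" by blast
          then obtain m where m: "\<And>d' g. agree m d d' \<Longrightarrow> agree m f g \<Longrightarrow> \<not> KL (L n) a d' g"
            using open_relE[OF KL_closed] by blast
          have "\<not> KL (L (max m n)) a d g" if "agree (max m n) f g" for g
            using m[of d g] that KL_mono[of "max m n" a d g n] agree_mono[OF that, of m] by auto
          then show "\<exists>m. \<forall>g. agree m f g \<longrightarrow> \<not> KL (L m) a d g" by blast
        qed (use KL_mono in blast)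
        with ne show False by blast
      qed
    next
      case False
      then show ?thesis using ex unfolding KL_def by blast
    qed
    then obtain f where f: "\<And>n. KL (L n) a d f" by blast
    have "U r d f \<notin> the (COH d)" if fam: "fam r = a" for r
    proof
      assume sol: "U r d f \<in> the (COH d)"
      then have inf: "infinite (Collect (U r d f))" by (simp add: COH_def)
      show False
      proof (cases "\<exists>n. r \<in> dom (L n)")
        case True
        then obtain n b s where "L n r = Some (b, s)" by auto
        then have "\<not> s \<le> pos r z" if "U r d f z" for z
          using f[of n] fam that unfolding KL_def by blast
        then have "z < s" if "U r d f z" for z
          using that pos_ge[where r = r and z = z] by force
        then have "Collect (U r d f) \<subseteq> {..<s}" by auto
        with inf show False using finite_subset by blast
      next
        case False
        from sol obtain F k where F: "finite F"
          "\<And>z. U r d f z \<Longrightarrow> z \<notin> F \<Longrightarrow> d (pos r z) = k"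
          unfolding COH_def sequence_of_def pos_def option.sel mem_Collect_eq Ball_def Diff_iff by metis
        obtain B where B: "\<And>z. z \<in> F \<Longrightarrow> pos r z < B"
          using finite_nat_set_iff_bounded[of "pos r ` F"] F(1) by auto
        have "infinite (range (\<lambda>k'. to_nat (r, \<not> k, k' :: nat)))"
          by (rule range_inj_infinite) (simp add: inj_def)
        then obtain k' where k': "B \<le> to_nat (r, \<not> k, k' :: nat)"
          by (auto simp: infinite_nat_iff_unbounded_le)
        \<comment> \<open>A stage at which \<open>r\<close> is asked about the value \<open>\<not> k\<close> and all positions of \<open>F\<close> are in the past.\<close>
        define n where "n = to_nat (r, \<not> k, k')"
        have "task n = (r, \<not> k, k')" by (simp add: task_def n_def)
        then have "step r (\<not> k) (S n) (S (Suc n))" using S_step[of n] by simp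
        then have "KL (L n) (fam r) d f \<longrightarrow>
            (\<exists>z. t n \<le> pos r z \<and> U r d f z \<and> d (pos r z) = (\<not> k))"
          using False d_agr[of "Suc n"] unfolding step_def S prod.case by blast
        then obtain z where z: "t n \<le> pos r z" "U r d f z" "d (pos r z) = (\<not> k)"
          using f[of n] fam by blast
        have "B \<le> t n"
          using strict_mono_imp_increasing[OF t_mono, of n] k' by (simp add: n_def)
        then have "z \<notin> F" using B z(1) by fastforce
        with F(2) z show False by auto
      qed
    qed
    with f show "\<exists>f. K a d f \<and> (\<forall>r. fam r = a \<longrightarrow> U r d f \<notin> the (COH d))"
      unfolding KL_def by blast
  qed
qed

end

section \<open>Greedy homogeneous sets\<close>

definition has_color :: "(nat \<times> nat \<Rightarrow> bool) \<Rightarrow> bool \<Rightarrow> nat set \<Rightarrow> bool" where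
  "has_color e i H \<longleftrightarrow> (\<forall>p \<in> pairs H. e p = i)"

lemma has_color_iff: "has_color e i H \<longleftrightarrow> (\<forall>x\<in>H. \<forall>y\<in>H. x < y \<longrightarrow> e (x, y) = i)"
  by (auto simp: has_color_def pairs_def)

lemma has_color_homogeneous: "has_color e i H \<Longrightarrow> homogeneous e H"
  unfolding has_color_def homogeneous_def by blast

function greedy :: "(nat \<times> nat \<Rightarrow> bool) \<Rightarrow> bool \<Rightarrow> (nat \<Rightarrow> bool) \<Rightarrow> cantor" where
  "greedy e i R n \<longleftrightarrow> R n \<and> (\<forall>m\<in>{..<n}. greedy e i R m \<longrightarrow> e (m, n) = i)"
  by pat_completeness auto
termination by (relation "measure (\<lambda>(e, i, R, n). n)") auto

declare greedy.simps [simp del]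

lemma greedy_has_color: "has_color e i (Collect (greedy e i R))"
  unfolding has_color_iff by (metis greedy.simps lessThan_iff mem_Collect_eq)

lemma greedy_cong:
  assumes "\<And>y. y < k \<Longrightarrow> R y = R' y" "\<And>x y. x < y \<Longrightarrow> y < k \<Longrightarrow> e (x, y) = e' (x, y)" "n < k"
  shows "greedy e i R n = greedy e' i R' n"
  using assms(3)
proof (induction n rule: less_induct)
  case (less n)
  then show ?case
    using assms(1,2) by (subst (1 2) greedy.simps) auto
qed

text \<open>
  If the greedy set were finite, almost every point of \<open>R\<close> would be compatible with all its members.
\<close>

lemma greedy_infinite:
  assumes "infinite (Collect R)" "\<And>x. R x \<Longrightarrow> finite {y. R y \<and> e (x, y) \<noteq> i}"
  shows "infinite (Collect (greedy e i R))"
proof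
  assume fin: "finite (Collect (greedy e i R))"
  define B where "B = (\<Union>x\<in>Collect (greedy e i R). {..x} \<union> {y. R y \<and> e (x, y) \<noteq> i})"
  have "finite B"
    unfolding B_def
  proof (rule finite_UN_I[OF fin])
    fix x assume "x \<in> Collect (greedy e i R)"
    then have "R x" using greedy.simps by blast
    then show "finite ({..x} \<union> {y. R y \<and> e (x, y) \<noteq> i})" using assms(2) by simp
  qed
  then have "infinite (Collect R - B)" using assms(1) by (rule Diff_infinite_finite)
  then obtain y where "y \<in> Collect R - B" using infinite_imp_nonempty by blast
  then have y: "R y" "\<And>x. greedy e i R x \<Longrightarrow> x < y \<and> e (x, y) = i"
    unfolding B_def by auto
  then have "greedy e i R y" by (subst greedy.simps) blast
  with y(2) show False by blast
qed

definition neighbors :: "(nat \<times> nat \<Rightarrow> bool) \<Rightarrow> bool \<Rightarrow> nat set \<Rightarrow> (nat \<Rightarrow> bool) \<Rightarrow> nat \<Rightarrow> bool" where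
  "neighbors e j A R y \<longleftrightarrow> R y \<and> (\<forall>a\<in>A. a < y \<and> e (a, y) = j)"

text \<open>
  Grow a homogeneous set of color \<open>j\<close> point by point, keeping infinitely many common \<open>j\<close>-neighbors.  If no
  point can be added to a finite set \<open>A\<close>, then each common neighbor \<open>x\<close> of \<open>A\<close> has color \<open>\<not> j\<close> with almost all the
  others, which makes the greedy search for the opposite color succeed.
\<close>

lemma infinite_homogeneous_subset:
  assumes "infinite (Collect R)"
    and fin: "\<And>A. finite A \<Longrightarrow> finite (Collect (greedy e (\<not> j) (neighbors e j A R)))"
  shows "\<exists>H. infinite H \<and> H \<subseteq> Collect R \<and> has_color e j H"
proof -
  define P where "P A \<longleftrightarrow> finite A \<and> A \<subseteq> Collect R \<and> has_color e j A \<and>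
    infinite (Collect (neighbors e j A R))" for A
  have "\<exists>A. \<forall>n. P (A n) \<and> A n \<subset> A (Suc n)"
  proof (rule dependent_nat_choice)
    show "\<exists>A. P A"
      using assms(1) unfolding P_def has_color_iff
      by (intro exI[of _ "{}"]) (simp add: neighbors_def[abs_def])
  next
    fix A n assume A: "P A"
    then have "\<not> (\<forall>x. neighbors e j A R x \<longrightarrow>
      finite {y. neighbors e j A R y \<and> e (x, y) \<noteq> (\<not> j)})"
      using fin greedy_infinite unfolding P_def by blast
    then obtain x where x: "neighbors e j A R x"
      and inf: "infinite {y. neighbors e j A R y \<and> e (x, y) \<noteq> (\<not> j)}" by blast
    have "infinite ({y. neighbors e j A R y \<and> e (x, y) \<noteq> (\<not> j)} - {..x})"
      using inf by (rule Diff_infinite_finite[rotated]) simp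
    moreover have "{y. neighbors e j A R y \<and> e (x, y) \<noteq> (\<not> j)} - {..x} \<subseteq>
      Collect (neighbors e j (insert x A) R)"
      by (auto simp: neighbors_def)
    ultimately have "infinite (Collect (neighbors e j (insert x A) R))"
      using finite_subset by blast
    then have "P (insert x A)"
      using A x by (fastforce simp: P_def has_color_iff neighbors_def)
    moreover have "x \<notin> A" using x by (auto simp: neighbors_def)
    ultimately show "\<exists>A'. P A' \<and> A \<subset> A'"
      by (intro exI[of _ "insert x A"]) auto
  qed
  then obtain A where "\<forall>n. P (A n) \<and> A n \<subset> A (Suc n)" ..
  then have A: "P (A n)" "A n \<subset> A (Suc n)" for n by simp_all
  have chain: "A m \<subseteq> A n" if "m \<le> n" for m n
    by (rule lift_Suc_mono_le[OF _ that]) (rule psubset_imp_subset[OF A(2)])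
  have "infinite (\<Union>(range A))"
  proof
    assume fin: "finite (\<Union>(range A))"
    have "n \<le> card (A n)" for n
    proof (induction n)
      case (Suc n)
      then show ?case
        using psubset_card_mono[OF _ A(2)[of n]] A(1)[of "Suc n"] by (simp add: P_def)
    qed simp
    moreover have "card (A n) \<le> card (\<Union>(range A))" for n
      using fin by (intro card_mono) auto
    ultimately show False by (metis le_trans not_less_eq_eq)
  qed
  moreover have "has_color e j (\<Union>(range A))"
    unfolding has_color_iff
  proof (intro ballI impI)
    fix x y assume "x \<in> \<Union>(range A)" "y \<in> \<Union>(range A)" "x < y"
    then obtain m n where "x \<in> A m" "y \<in> A n" by blast
    then have "x \<in> A (max m n)" "y \<in> A (max m n)"
      using chain[of m "max m n"] chain[of n "max m n"] by auto
    with A(1)[of "max m n"] \<open>x < y\<close> show "e (x, y) = j" by (auto simp: P_def has_color_iff)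
  qed
  moreover have "\<Union>(range A) \<subseteq> Collect R" using A(1) by (auto simp: P_def)
  ultimately show ?thesis by blast
qed

section \<open>Late switches against committed pairs\<close>

text \<open>
  The value \<open>M = 0\<close> encodes the coloring that never switches.
\<close>

definition switch :: "nat \<Rightarrow> cantor" where
  "switch M p \<longleftrightarrow> 0 < M \<and> M \<le> p"

lemma agree_switch: "m \<le> M \<Longrightarrow> agree m (switch 0) (switch M)"
  by (auto simp: agree_def switch_def)

lemma stable_switch: "stable (coloring_of (switch M))"
  unfolding stable_def
proof
  fix x
  have "\<forall>\<^sub>F y in sequentially. coloring_of (switch M) (x, y) = (0 < M)"
    using eventually_ge_at_top[of M]
    by eventually_elim
      (use le_prod_encode_2 order_trans in \<open>fastforce simp: coloring_of_def switch_def\<close>)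
  then show "\<exists>k. \<forall>\<^sub>F y in sequentially. coloring_of (switch M) (x, y) = k" ..
qed

text \<open>
  What a reduction provides: \<open>e X\<close> is the instance of \<open>RT22\<close> computed from \<open>X\<close>, and \<open>W X H n\<close> says that the
  backward functional answers \<open>1\<close> at \<open>n\<close>, given \<open>X\<close> and the solution \<open>H\<close>.  The even places of the answer are the
  solution of the stable coloring, the odd ones the cohesive set.
\<close>

locale continuous_reduction =
  fixes e :: "cantor \<Rightarrow> nat \<times> nat \<Rightarrow> bool"
    and W :: "cantor \<Rightarrow> cantor \<Rightarrow> nat \<Rightarrow> bool"
  assumes e_use: "\<exists>m. \<forall>X'. agree m (switch M \<oplus> d) X' \<longrightarrow> e X' p = e (switch M \<oplus> d) p"
    and W_use: "W X H n \<Longrightarrow> \<exists>m. \<forall>X' H'. agree m X X' \<longrightarrow> agree m H H' \<longrightarrow> W X' H' n"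
    and solves: "infinite (Collect H) \<Longrightarrow> homogeneous (e (switch M \<oplus> d)) (Collect H) \<Longrightarrow>
      (\<lambda>n. W (switch M \<oplus> d) H (2 * n)) \<in> the (RT22 (switch M)) \<and>
      (\<lambda>n. W (switch M \<oplus> d) H (2 * n + 1)) \<in> the (COH d)"
begin

lemma e_block_use:
  "\<exists>m. \<forall>X'. agree m (switch M \<oplus> d) X' \<longrightarrow> (\<forall>x<N. \<forall>y<N. e X' (x, y) = e (switch M \<oplus> d) (x, y))"
proof -
  have "\<exists>m. \<forall>p\<in>{..<N}\<times>{..<N}. \<forall>X'. agree m (switch M \<oplus> d) X' \<longrightarrow> e X' p = e (switch M \<oplus> d) p"
  proof (rule uniform_bound)
    show "\<exists>m. \<forall>X'. agree m (switch M \<oplus> d) X' \<longrightarrow> e X' p = e (switch M \<oplus> d) p" for p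
      by (rule e_use)
  qed (simp, meson agree_mono)
  then obtain m where "\<forall>p\<in>{..<N}\<times>{..<N}. \<forall>X'. agree m (switch M \<oplus> d) X' \<longrightarrow>
    e X' p = e (switch M \<oplus> d) p" ..
  then show ?thesis by (meson SigmaI lessThan_iff)
qed

text \<open>
  The homogeneous sets from which a cohesive set must not be obtained.  The set \<open>R\<close> to be searched is a
  color class of \<open>f\<close>.
\<close>

definition candidate :: "nat \<Rightarrow> bool \<Rightarrow> bool \<Rightarrow> nat set \<Rightarrow> cantor \<Rightarrow> cantor \<Rightarrow> cantor" where
  "candidate M s j A d f =
    greedy (e (switch M \<oplus> d)) (\<not> j) (neighbors (e (switch M \<oplus> d)) j A (\<lambda>y. f y = s))"

lemma candidate_use:
  "\<exists>m. \<forall>d' f'. agree m d d' \<longrightarrow> agree m f f' \<longrightarrow>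
    agree k (candidate M s j A d f) (candidate M s j A d' f')"
proof -
  obtain m where m: "\<And>X' x y. agree m (switch M \<oplus> d) X' \<Longrightarrow> x < k \<Longrightarrow> y < k \<Longrightarrow>
    e X' (x, y) = e (switch M \<oplus> d) (x, y)" using e_block_use[of M d k] by blast
  show ?thesis
  proof (intro exI allI impI)
    fix d' f' assume d': "agree (max m k) d d'" and f': "agree (max m k) f f'"
    have eq: "e (switch M \<oplus> d') (x, y) = e (switch M \<oplus> d) (x, y)" if "x < k" "y < k" for x y
      by (rule m[OF agree_join[OF agree_refl agree_mono[OF d']]]) (use that in simp_all)
    show "agree k (candidate M s j A d f) (candidate M s j A d' f')"
      unfolding agree_def candidate_def
    proof (intro allI impI, rule greedy_cong)
      fix y assume "y < k"
      then have "f y = f' y" using f' by (simp add: agree_def)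
      moreover have "(a < y \<and> e (switch M \<oplus> d) (a, y) = j) \<longleftrightarrow>
        (a < y \<and> e (switch M \<oplus> d') (a, y) = j)" for a
        using eq[of a y] \<open>y < k\<close> by auto
      ultimately show "neighbors (e (switch M \<oplus> d)) j A (\<lambda>y. f y = s) y =
        neighbors (e (switch M \<oplus> d')) j A (\<lambda>y. f' y = s) y"
        unfolding neighbors_def by simp
    qed (use eq in auto)
  qed
qed

text \<open>
  The candidates are homogeneous, so an infinite one would yield a cohesive set for \<open>d\<close>: tameness
  is how the failure of all candidates to do so shows up.
\<close>

definition tame :: "nat \<Rightarrow> cantor \<Rightarrow> cantor \<Rightarrow> bool" where
  "tame M d f \<longleftrightarrow> (\<forall>s j A. finite A \<longrightarrow> finite (Collect (candidate M s j A d f)))"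

lemma tame_homogeneous_subset:
  assumes "tame M d f" "infinite {y. f y = s}"
  obtains H where "infinite H" "\<And>y. y \<in> H \<Longrightarrow> f y = s" "has_color (e (switch M \<oplus> d)) j H"
proof -
  have "\<exists>H. infinite H \<and> H \<subseteq> {y. f y = s} \<and> has_color (e (switch M \<oplus> d)) j H"
  proof (rule infinite_homogeneous_subset[OF assms(2)])
    fix A :: "nat set"
    assume "finite A"
    with assms(1) show "finite (Collect (greedy (e (switch M \<oplus> d)) (\<not> j)
        (neighbors (e (switch M \<oplus> d)) j A (\<lambda>y. f y = s))))"
      unfolding tame_def candidate_def by metis
  qed
  then obtain H where "infinite H" "H \<subseteq> {y. f y = s}" "has_color (e (switch M \<oplus> d)) j H"
    by (elim exE conjE)
  then show thesis by (intro that[of H]) auto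
qed

text \<open>
  Some finite set \<open>F\<close> whose color matches \<open>f\<close> forces two numbers into the solution of the constant coloring.
  The one number \<open>N\<close> bounds everything involved, including the use of the computations; \<open>X\<close> and \<open>H\<close>
  range over all continuations of these finite data, so that the coloring may switch after
  \<open>N\<close> and \<open>F\<close> may be prolonged by numbers from \<open>N\<close> on.
\<close>

definition committed :: "nat \<Rightarrow> cantor \<Rightarrow> cantor \<Rightarrow> bool" where
  "committed N d f \<longleftrightarrow> (\<exists>F i x y. F \<subseteq> {..<N} \<and> (\<forall>a\<in>F. f a = i) \<and>
     has_color (e (switch 0 \<oplus> d)) i F \<and> x < y \<and> prod_encode (x, y) < N \<and>
     (\<forall>X H. agree N (switch 0 \<oplus> d) X \<longrightarrow> agree N (\<lambda>k. k \<in> F) H \<longrightarrow> W X H (2 * x) \<and> W X H (2 * y)))"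

lemma committed_mono: "committed N d f \<Longrightarrow> N \<le> N' \<Longrightarrow> committed N' d f"
proof -
  assume "committed N d f" and le: "N \<le> N'"
  then obtain F i x y where F: "F \<subseteq> {..<N}" "\<forall>a\<in>F. f a = i"
    "has_color (e (switch 0 \<oplus> d)) i F" "x < y" "prod_encode (x, y) < N"
    and W: "\<forall>X H. agree N (switch 0 \<oplus> d) X \<longrightarrow> agree N (\<lambda>k. k \<in> F) H \<longrightarrow>
      W X H (2 * x) \<and> W X H (2 * y)"
    unfolding committed_def by (elim exE conjE)
  from F(1) le have "F \<subseteq> {..<N'}" by auto
  moreover from F(5) le have "prod_encode (x, y) < N'" by simp
  moreover have "\<forall>X H. agree N' (switch 0 \<oplus> d) X \<longrightarrow> agree N' (\<lambda>k. k \<in> F) H \<longrightarrow>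
      W X H (2 * x) \<and> W X H (2 * y)"
    using W agree_mono[OF _ le] by blast
  ultimately show ?thesis unfolding committed_def using F(2-4) by blast
qed

lemma committed_use:
  assumes "committed N d f"
  shows "\<exists>m. \<forall>d' f'. agree m d d' \<longrightarrow> agree m f f' \<longrightarrow> committed N d' f'"
proof -
  obtain m where m: "\<And>X' x y. agree m (switch 0 \<oplus> d) X' \<Longrightarrow> x < N \<Longrightarrow> y < N \<Longrightarrow>
    e X' (x, y) = e (switch 0 \<oplus> d) (x, y)" using e_block_use[of 0 d N] by blast
  from assms obtain F i x y where F: "F \<subseteq> {..<N}" "\<forall>a\<in>F. f a = i"
    "has_color (e (switch 0 \<oplus> d)) i F" "x < y" "prod_encode (x, y) < N"
    and W: "\<And>X H. agree N (switch 0 \<oplus> d) X \<Longrightarrow> agree N (\<lambda>k. k \<in> F) H \<Longrightarrow> W X H (2 * x) \<and> W X H (2 * y)"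
    unfolding committed_def by blast
  show ?thesis
  proof (intro exI allI impI)
    fix d' f' assume d': "agree (max m N) d d'" and f': "agree (max m N) f f'"
    have agr: "agree (max m N) (switch 0 \<oplus> d) (switch 0 \<oplus> d')"
      using agree_join[OF agree_refl d'] .
    have "has_color (e (switch 0 \<oplus> d')) i F"
      using F(1,3) m[OF agree_mono[OF agr]] unfolding has_color_iff by (auto simp: subset_iff)
    moreover have "\<forall>a\<in>F. f' a = i"
      using F(1,2) f' unfolding agree_def by (metis lessThan_iff max.strict_coboundedI2 subsetD)
    moreover have "W X H (2 * x) \<and> W X H (2 * y)"
      if "agree N (switch 0 \<oplus> d') X" "agree N (\<lambda>k. k \<in> F) H" for X H
      using W that agree_trans agree_mono[OF agr, of N] by auto
    ultimately show "committed N d' f'"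
      using F(1,4,5) unfolding committed_def by blast
  qed
qed

text \<open>
  The solution obtained from the infinite set \<open>H\<close> is infinite, and two of its members are determined by an
  initial segment of \<open>H\<close>.
\<close>

lemma homogeneous_set_commits:
  assumes "infinite H" "has_color (e (switch 0 \<oplus> d)) i H" "\<And>y. y \<in> H \<Longrightarrow> f y = i"
  shows "\<exists>N. committed N d f"
proof -
  let ?X = "switch 0 \<oplus> d" and ?H = "\<lambda>k. k \<in> H"
  have "infinite {n. W ?X ?H (2 * n)}"
    using solves[of ?H 0 d] assms unfolding RT22_def homogeneous_def has_color_def by auto
  then obtain x y where xy: "W ?X ?H (2 * x)" "W ?X ?H (2 * y)" "x < y"
    unfolding infinite_nat_iff_unbounded by blast
  obtain m1 m2 where m: "\<And>X' H'. agree m1 ?X X' \<Longrightarrow> agree m1 ?H H' \<Longrightarrow> W X' H' (2 * x)"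
    "\<And>X' H'. agree m2 ?X X' \<Longrightarrow> agree m2 ?H H' \<Longrightarrow> W X' H' (2 * y)"
    using W_use[OF xy(1)] W_use[OF xy(2)] by blast
  define N where "N = max (max m1 m2) (Suc (prod_encode (x, y)))"
  have "W X' H' (2 * x) \<and> W X' H' (2 * y)"
    if "agree N ?X X'" "agree N (\<lambda>k. k \<in> H \<inter> {..<N}) H'" for X' H'
  proof -
    have "agree N ?H H'" using that(2) by (auto simp: agree_def)
    then show ?thesis
      using m that(1) agree_mono[of N _ _ m1] agree_mono[of N _ _ m2] by (auto simp: N_def)
  qed
  moreover have "has_color (e ?X) i (H \<inter> {..<N})" using assms(2) by (auto simp: has_color_iff)
  moreover have "prod_encode (x, y) < N" by (simp add: N_def)
  ultimately have "committed N d f"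
    unfolding committed_def using xy(3) assms(3)
    by (intro exI[of _ "H \<inter> {..<N}"] exI[of _ i] exI[of _ x] exI[of _ y]) auto
  then show ?thesis ..
qed

text \<open>
  The points whose colors with the first \<open>length g\<close> numbers are given by \<open>g\<close>: on such a set the coloring has
  limits at these numbers.
\<close>

definition column_set :: "nat \<Rightarrow> bool list \<Rightarrow> cantor \<Rightarrow> cantor" where
  "column_set M g d y \<longleftrightarrow> length g \<le> y \<and> (\<forall>x<length g. e (switch M \<oplus> d) (x, y) = g ! x)"

lemma column_set_use: "\<exists>m. \<forall>d'. agree m d d' \<longrightarrow> column_set M g d' y = column_set M g d y"
proof -
  obtain m where m: "\<And>X' x z. agree m (switch M \<oplus> d) X' \<Longrightarrow> x < Suc y \<Longrightarrow> z < Suc y \<Longrightarrow>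
    e X' (x, z) = e (switch M \<oplus> d) (x, z)" using e_block_use[of M d "Suc y"] by blast
  have "column_set M g d' y = column_set M g d y" if "agree m d d'" for d'
    using m[OF agree_join[OF agree_refl that]] unfolding column_set_def by auto
  then show ?thesis by blast
qed

lemma column_set_infinite:
  "\<exists>g. length g = N \<and> infinite (Collect (column_set M g d))"
proof -
  define h where "h y = map (\<lambda>x. e (switch M \<oplus> d) (x, y)) [0..<N]" for y
  have "finite (h ` {N..})"
    by (rule finite_subset[OF _ finite_lists_length_eq[of UNIV N]]) (auto simp: h_def)
  then obtain y0 where y0: "infinite {y \<in> {N..}. h y = h y0}"
    using pigeonhole_infinite[of "{N..}" h] by (auto simp: infinite_Ici)
  have "{y \<in> {N..}. h y = h y0} \<subseteq> Collect (column_set M (h y0) d)"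
    by (auto simp: column_set_def h_def)
  then have "infinite (Collect (column_set M (h y0) d))" using y0 finite_subset by blast
  then show ?thesis by (intro exI[of _ "h y0"]) (simp add: h_def)
qed

text \<open>
  The diagonalization is applied to countably many closed sets.  One consists of the \<open>f\<close> that are
  never committed, for the constant coloring; it may be empty.  The others contain a single point \<open>f\<close>, the
  characteristic function of \<open>column_set M g d\<close>.
\<close>

lemma sequence_taming_candidates:
  obtains d where
    "(\<exists>f. \<forall>N. \<not> committed N d f) \<Longrightarrow> \<exists>f. (\<forall>N. \<not> committed N d f) \<and> tame 0 d f"
    and "\<And>M g. tame M d (column_set M g d)"
proof -
  define K where "K a d f = (case a of None \<Rightarrow> \<forall>N. \<not> committed N d f
    | Some (M, g) \<Rightarrow> f = column_set M g d)" for a :: "(nat \<times> bool list) option" and d f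
  define stage where "stage a = (case a of None \<Rightarrow> 0 | Some (M, g) \<Rightarrow> M)"
    for a :: "(nat \<times> bool list) option"
  define U where "U = (\<lambda>(a, s, j, A) d f z. W (switch (stage a) \<oplus> d)
    (candidate (stage a) s j (set A) d f) (2 * z + 1))"
  define fam where "fam = (fst :: (nat \<times> bool list) option \<times> bool \<times> bool \<times> nat list \<Rightarrow> _)"
  have K_closed: "open_rel (\<lambda>d f. \<not> K a d f)" for a
  proof (cases a)
    case None
    then show ?thesis
      using committed_use unfolding K_def open_rel_def by simp blast
  next
    case (Some Mg)
    obtain M g where a: "a = Some (M, g)" using Some by (cases Mg) auto
    show ?thesis
      unfolding open_rel_def
    proof (intro allI impI)
      fix d f assume "\<not> K a d f"
      then obtain y where y: "f y \<noteq> column_set M g d y" by (auto simp: K_def a)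
      obtain m where m: "\<And>d'. agree m d d' \<Longrightarrow> column_set M g d' y = column_set M g d y"
        using column_set_use[of d M g y] by blast
      have "\<not> K a d' f'" if d': "agree (max m (Suc y)) d d'" and f': "agree (max m (Suc y)) f f'" for d' f'
      proof -
        have "f' y = f y" using f' by (simp add: agree_def)
        with y m[OF agree_mono[OF d']] show ?thesis by (auto simp: K_def a)
      qed
      then show "\<exists>m. \<forall>d' f'. agree m d d' \<longrightarrow> agree m f f' \<longrightarrow> \<not> K a d' f'" by blast
    qed
  qed
  have U_open: "open_rel (\<lambda>d f. U r d f z)" for r z
  proof -
    obtain a s j A where r: "r = (a, s, j, A)" by (cases r)
    let ?M = "stage a" and ?C = "candidate (stage a) s j (set A)"
    show ?thesis
      unfolding open_rel_def
    proof (intro allI impI)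
      fix d f assume "U r d f z"
      then obtain m where m: "\<And>X' H'. agree m (switch ?M \<oplus> d) X' \<Longrightarrow> agree m (?C d f) H' \<Longrightarrow>
        W X' H' (2 * z + 1)" using W_use unfolding U_def r by auto blast
      obtain k where k: "\<And>d' f'. agree k d d' \<Longrightarrow> agree k f f' \<Longrightarrow> agree m (?C d f) (?C d' f')"
        using candidate_use by blast
      have "U r d' f' z" if "agree (max m k) d d'" "agree (max m k) f f'" for d' f'
        unfolding U_def r prod.case
        by (intro m k agree_join agree_refl) (use that in \<open>auto elim: agree_mono\<close>)
      then show "\<exists>m. \<forall>d' f'. agree m d d' \<longrightarrow> agree m f f' \<longrightarrow> U r d' f' z" by blast
    qed
  qed
  obtain d where d: "\<And>a. \<exists>f. K a d f \<Longrightarrow>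
      \<exists>f. K a d f \<and> (\<forall>r. fam r = a \<longrightarrow> U r d f \<notin> the (COH d))"
    using no_uniformly_computed_cohesive_set[of K U fam, OF K_closed U_open] by blast
  have tame: "\<exists>f. K a d f \<and> tame (stage a) d f" if ex: "\<exists>f. K a d f" for a
  proof -
    obtain f where f: "K a d f" "\<And>r. fam r = a \<Longrightarrow> U r d f \<notin> the (COH d)" using d[OF ex] by blast
    have "finite (Collect (candidate (stage a) s j A d f))" if A: "finite A" for s j A
    proof (rule ccontr)
      assume inf: "infinite (Collect (candidate (stage a) s j A d f))"
      obtain xs where xs: "A = set xs" using A finite_list by blast
      have "homogeneous (e (switch (stage a) \<oplus> d)) (Collect (candidate (stage a) s j A d f))"
        unfolding candidate_def by (rule has_color_homogeneous[OF greedy_has_color])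
      then have "U (a, s, j, xs) d f \<in> the (COH d)"
        using solves[OF inf] by (simp add: U_def xs)
      with f(2)[of "(a, s, j, xs)"] show False by (simp add: fam_def)
    qed
    with f(1) show ?thesis unfolding tame_def by blast
  qed
  show thesis
  proof
    show "\<exists>f. (\<forall>N. \<not> committed N d f) \<and> tame 0 d f" if "\<exists>f. \<forall>N. \<not> committed N d f"
      using tame[of None] that by (simp add: K_def stage_def)
    show "tame M d (column_set M g d)" for M g
      using tame[of "Some (M, g)"] by (simp add: K_def stage_def)
  qed
qed

lemma no_continuous_reduction: False
proof -
  obtain d where d0: "(\<exists>f. \<forall>N. \<not> committed N d f) \<Longrightarrow> \<exists>f. (\<forall>N. \<not> committed N d f) \<and> tame 0 d f"
    and d1: "\<And>M g. tame M d (column_set M g d)" using sequence_taming_candidates by blast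
  \<comment> \<open>Otherwise some uncommitted \<open>f\<close> is tame.  An infinite color class of \<open>f\<close> then contains an infinite
     homogeneous set of the same color, whose initial segments do commit.\<close>
  have all: "\<exists>N. committed N d f" for f
  proof (rule ccontr)
    assume "\<nexists>N. committed N d f"
    then obtain f where f: "\<And>N. \<not> committed N d f" "tame 0 d f" using d0 by blast
    have "{y. f y = True} \<union> {y. f y = False} = UNIV" by auto
    then have "infinite {y. f y = True} \<or> infinite {y. f y = False}"
      by (metis finite_Un infinite_UNIV_nat)
    then obtain s where "infinite {y. f y = s}" by blast
    then obtain H where "infinite H" "\<And>y. y \<in> H \<Longrightarrow> f y = s" "has_color (e (switch 0 \<oplus> d)) s H"
      using tame_homogeneous_subset[OF f(2)] by blast
    with homogeneous_set_commits f(1) show False by blast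
  qed
  have "\<exists>N. \<forall>f. committed N d f"
  proof (rule fan)
    fix f
    obtain N where "committed N d f" using all by blast
    then obtain m where m: "\<And>f'. agree m f f' \<Longrightarrow> committed N d f'"
      using committed_use agree_refl by blast
    have "committed (max m N) d f'" if "agree (max m N) f f'" for f'
      using m[OF agree_mono[OF that]] committed_mono by simp
    then show "\<exists>m. \<forall>g. agree m f g \<longrightarrow> committed m d g" by blast
  qed (rule committed_mono)
  then obtain N where N: "\<And>f. committed N d f" by blast
  obtain m where m: "\<And>X' x y. agree m (switch 0 \<oplus> d) X' \<Longrightarrow> x < N \<Longrightarrow> y < N \<Longrightarrow>
    e X' (x, y) = e (switch 0 \<oplus> d) (x, y)" using e_block_use[of 0 d N] by blast
  \<comment> \<open>Switch so late that neither the commitments nor the coloring below \<open>N\<close> are affected.  The successor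
     makes \<open>M\<close> nonzero.\<close>
  define M where "M = max (Suc m) N"
  let ?X = "switch M \<oplus> d"
  have agr: "agree M (switch 0 \<oplus> d) ?X" by (intro agree_join agree_switch) auto
  obtain g where g: "length g = N" "infinite (Collect (column_set M g d))"
    using column_set_infinite by blast
  \<comment> \<open>The limits \<open>g\<close> are the \<open>f\<close> that selects \<open>F\<close>.  The values of \<open>g ! a\<close> for \<open>a \<ge> N\<close> are arbitrary, as
     \<open>F\<close> lies below \<open>N\<close>.\<close>
  obtain F i x y where F: "F \<subseteq> {..<N}" "\<And>a. a \<in> F \<Longrightarrow> g ! a = i"
    "has_color (e (switch 0 \<oplus> d)) i F" and xy: "x < y" "prod_encode (x, y) < N"
    and W: "\<And>X H. agree N (switch 0 \<oplus> d) X \<Longrightarrow> agree N (\<lambda>k. k \<in> F) H \<Longrightarrow> W X H (2 * x) \<and> W X H (2 * y)"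
    using N[of "\<lambda>a. g ! a"] unfolding committed_def by blast
  obtain H' where H': "infinite H'" "\<And>y. y \<in> H' \<Longrightarrow> column_set M g d y" "has_color (e ?X) i H'"
    using tame_homogeneous_subset[OF d1, of M g True] g(2) by auto
  define H where "H = F \<union> H'"
  have H'_ge: "N \<le> y" if "y \<in> H'" for y using H'(2)[OF that] g(1) by (simp add: column_set_def)
  have "has_color (e ?X) i H"
    unfolding has_color_iff
  proof (intro ballI impI)
    fix a b assume ab: "a \<in> H" "b \<in> H" "a < b"
    consider "a \<in> F" "b \<in> F" | "a \<in> F" "b \<in> H'" | "a \<in> H'" "b \<in> H'"
      using ab F(1) H'_ge unfolding H_def by fastforce
    then show "e ?X (a, b) = i"
    proof cases
      case 1
      then have "e ?X (a, b) = e (switch 0 \<oplus> d) (a, b)"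
        by (intro m agree_mono[OF agr]) (use F(1) in \<open>auto simp: M_def\<close>)
      with 1 F(3) ab(3) show ?thesis by (simp add: has_color_iff)
    next
      case 2
      then show ?thesis using H'(2) F(1,2) g(1) by (auto simp: column_set_def)
    next
      case 3
      then show ?thesis using H'(3) ab(3) by (simp add: has_color_iff)
    qed
  qed
  then have "homogeneous (e ?X) H" by (rule has_color_homogeneous)
  moreover have "infinite H" using H'(1) by (simp add: H_def)
  ultimately have "(\<lambda>n. W ?X (\<lambda>k. k \<in> H) (2 * n)) \<in> the (RT22 (switch M))"
    using solves[of "\<lambda>k. k \<in> H" M d] by simp
  then have inf: "infinite {n. W ?X (\<lambda>k. k \<in> H) (2 * n)}"
    and hom: "homogeneous (coloring_of (switch M)) {n. W ?X (\<lambda>k. k \<in> H) (2 * n)}"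
    by (simp_all add: RT22_def)
  have "agree N (\<lambda>k. k \<in> F) (\<lambda>k. k \<in> H)"
    using H'_ge by (fastforce simp: agree_def H_def)
  then have Wxy: "W ?X (\<lambda>k. k \<in> H) (2 * x)" "W ?X (\<lambda>k. k \<in> H) (2 * y)"
    using W agree_mono[OF agr, of N] by (auto simp: M_def)
  obtain z where z: "W ?X (\<lambda>k. k \<in> H) (2 * z)" "max x M < z"
    using inf unfolding infinite_nat_iff_unbounded by blast
  have "coloring_of (switch M) (x, y) = coloring_of (switch M) (x, z)"
    using hom Wxy z xy(1) unfolding homogeneous_def pairs_def by fastforce
  moreover have "\<not> coloring_of (switch M) (x, y)"
    using xy(2) by (simp add: coloring_of_def switch_def M_def)
  moreover have "coloring_of (switch M) (x, z)"
    using z(2) le_prod_encode_2[of z x] by (simp add: coloring_of_def switch_def M_def)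
  ultimately show False by simp
qed

end

theorem corollary2p8:
  shows "\<not> (SRT22 \<times>\<^sub>W COH \<le>\<^sub>W RT22)"
proof
  assume "SRT22 \<times>\<^sub>W COH \<le>\<^sub>W RT22"
  then obtain \<Phi> \<Psi> where red: "\<And>X. X \<in> dom (SRT22 \<times>\<^sub>W COH) \<Longrightarrow> \<exists>X' \<in> dom RT22.
      turing_functional \<Phi> X X' \<and> (\<forall>Y' \<in> the (RT22 X'). \<exists>Y \<in> the ((SRT22 \<times>\<^sub>W COH) X).
        turing_functional \<Psi> (X \<oplus> Y') Y)"
    unfolding weihrauch_reducible_def by blast
  define e where "e X p \<longleftrightarrow> converges X \<Phi> [prod_encode p] 1" for X p
  define W where "W X H n \<longleftrightarrow> converges (X \<oplus> H) \<Psi> [n] 1" for X H n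
  have tf: "turing_functional h X Y \<Longrightarrow> converges X h [n] 1 = Y n" for h X Y n
    unfolding turing_functional_def
    by (metis converges_deterministic of_bool_eq(1,2) zero_neq_one)
  have [simp]: "(\<lambda>n. (X \<oplus> Y) (2 * n)) = X" "(\<lambda>n. (X \<oplus> Y) (2 * n + 1)) = Y"
    "(\<lambda>n. (X \<oplus> Y) (Suc (2 * n))) = Y" for X Y
    by (auto simp: join_def)
  have prod: "(SRT22 \<times>\<^sub>W COH) (switch M \<oplus> d) =
    Some {Y\<^sub>0 \<oplus> Y\<^sub>1 | Y\<^sub>0 Y\<^sub>1. Y\<^sub>0 \<in> the (RT22 (switch M)) \<and> Y\<^sub>1 \<in> the (COH d)}" for M d
    using stable_switch[of M] by (simp add: product_def SRT22_def RT22_def COH_def dom_def restrict_map_def)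
  have ex: "\<exists>X'. turing_functional \<Phi> (switch M \<oplus> d) X' \<and> (\<forall>Y' \<in> the (RT22 X').
      \<exists>Y\<^sub>0 \<in> the (RT22 (switch M)). \<exists>Y\<^sub>1 \<in> the (COH d).
        turing_functional \<Psi> ((switch M \<oplus> d) \<oplus> Y') (Y\<^sub>0 \<oplus> Y\<^sub>1))" for M d
    using red[of "switch M \<oplus> d"] prod[of M d] by fastforce
  interpret continuous_reduction e W
  proof
    fix M d p
    obtain X' where "turing_functional \<Phi> (switch M \<oplus> d) X'" using ex by blast
    then have "converges (switch M \<oplus> d) \<Phi> [prod_encode p] (of_bool (X' (prod_encode p)))"
      by (simp add: turing_functional_def)
    then obtain m where "\<And>Z. agree m (switch M \<oplus> d) Z \<Longrightarrow>
        converges Z \<Phi> [prod_encode p] (of_bool (X' (prod_encode p)))"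
      using converges_use by blast
    then have "\<And>Z. agree m (switch M \<oplus> d) Z \<Longrightarrow> e Z p = X' (prod_encode p)"
      unfolding e_def by (metis converges_deterministic of_bool_eq(1,2) zero_neq_one)
    then show "\<exists>m. \<forall>Z. agree m (switch M \<oplus> d) Z \<longrightarrow> e Z p = e (switch M \<oplus> d) p"
      using agree_refl by metis
  next
    fix X H n assume "W X H n"
    then show "\<exists>m. \<forall>X' H'. agree m X X' \<longrightarrow> agree m H H' \<longrightarrow> W X' H' n"
      using converges_use agree_join unfolding W_def by meson
  next
    fix H M d
    assume inf: "infinite (Collect H)" and hom: "homogeneous (e (switch M \<oplus> d)) (Collect H)"
    obtain X' where X': "turing_functional \<Phi> (switch M \<oplus> d) X'" and sol: "\<And>Y'. Y' \<in> the (RT22 X') \<Longrightarrow>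
      \<exists>Y\<^sub>0 \<in> the (RT22 (switch M)). \<exists>Y\<^sub>1 \<in> the (COH d).
        turing_functional \<Psi> ((switch M \<oplus> d) \<oplus> Y') (Y\<^sub>0 \<oplus> Y\<^sub>1)" using ex by blast
    have "e (switch M \<oplus> d) = coloring_of X'"
      using tf[OF X'] by (simp add: fun_eq_iff e_def coloring_of_def)
    then have "H \<in> the (RT22 X')" using inf hom by (simp add: RT22_def)
    then obtain Y0 Y1 where Y: "Y0 \<in> the (RT22 (switch M))" "Y1 \<in> the (COH d)"
      "turing_functional \<Psi> ((switch M \<oplus> d) \<oplus> H) (Y0 \<oplus> Y1)" using sol by blast
    have "W (switch M \<oplus> d) H = Y0 \<oplus> Y1" using tf[OF Y(3)] by (simp add: fun_eq_iff W_def)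
    with Y(1,2) show "(\<lambda>n. W (switch M \<oplus> d) H (2 * n)) \<in> the (RT22 (switch M)) \<and>
      (\<lambda>n. W (switch M \<oplus> d) H (2 * n + 1)) \<in> the (COH d)" by simp
  qed
  show False by (rule no_continuous_reduction)
qed

end
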